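(* Let $G_1$ and $G_2$ be connected graphs on $n_1$ and $n_2$ vertices, respectively. Then $$BH(G_1\Box G_2)= n_1n_2\left(\sum_{i=2}^{n_1}\frac{1}{\lambda_i^2(G_1)}+\sum_{j=2}^{n_2}\frac{1}{\lambda_j^2(G_2)}+\sum_{i=2}^{n_1}\sum_{j=2}^{n_2}\frac{1}{(\lambda_i(G_1)+\lambda_j(G_2))^2}\right).$$
   Context: For a graph $H$ on $k$ vertices, $L(H)=D(H)-A(H)$ is its Laplacian matrix with eigenvalues $0=\lambda_1(H)\le\cdots\le\lambda_k(H)$. The biharmonic index of a connected graph $H$ on $k$ vertices is $BH(H)=\frac12\sum_{u,v}d_B^2(u,v)$ ($d_B^2$ the squared biharmonic distance), equivalently $BH(H)=k\sum_{i=2}^k\lambda_i(H)^{-2}$. The Cartesian product $G_1\Box G_2$ has vertex set $V(G_1)\times V(G_2)$, with $(u_i,v_s)$ adjacent to $(u_j,v_t)$ iff either $u_i=u_j$ and $v_sv_t\in E(G_2)$, or $v_s=v_t$ and $u_iu_j\in E(G_1)$. *)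

theory Defs
  imports "HOL-Analysis.Analysis" "HOL-Computational_Algebra.Computational_Algebra"
begin

text \<open>
  A finite simple graph is given by its adjacency relation on a finite vertex type;
  the number of vertices is the cardinality of that type.
\<close>

definition simple_graph :: "('a::finite \<Rightarrow> 'a \<Rightarrow> bool) \<Rightarrow> bool" where
  "simple_graph E \<longleftrightarrow> symp E \<and> irreflp E"

definition connected_graph :: "('a::finite \<Rightarrow> 'a \<Rightarrow> bool) \<Rightarrow> bool" where
  "connected_graph E \<longleftrightarrow> simple_graph E \<and> (\<forall>u v. E\<^sup>*\<^sup>* u v)"

definition degree_matrix :: "('a::finite \<Rightarrow> 'a \<Rightarrow> bool) \<Rightarrow> real ^ 'a ^ 'a" where
  "degree_matrix E = (\<chi> u v. if u = v then real (card {w. E u w}) else 0)"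

definition adjacency_matrix :: "('a::finite \<Rightarrow> 'a \<Rightarrow> bool) \<Rightarrow> real ^ 'a ^ 'a" where
  "adjacency_matrix E = (\<chi> u v. if E u v then 1 else 0)"

definition laplacian :: "('a::finite \<Rightarrow> 'a \<Rightarrow> bool) \<Rightarrow> real ^ 'a ^ 'a" where
  "laplacian E = degree_matrix E - adjacency_matrix E"

definition characteristic_poly :: "real ^ 'n ^ 'n \<Rightarrow> real poly" where
  "characteristic_poly A = det (mat [:0, 1:] - (\<chi> i j. [:A $ i $ j:]))"

text \<open>
  The eigenvalues are listed in increasing order, with multiplicity, and indexed from 1.
  Only real roots are collected; this loses nothing for a real symmetric matrix.
\<close>

definition laplacian_eigenvalue :: "('a::finite \<Rightarrow> 'a \<Rightarrow> bool) \<Rightarrow> nat \<Rightarrow> real" where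
  "laplacian_eigenvalue E i =
     sorted_list_of_multiset (proots (characteristic_poly (laplacian E))) ! (i - 1)"

text \<open>The Moore--Penrose inverse, as the unique solution of the four Penrose equations.\<close>

definition is_pseudoinverse :: "real ^ 'n ^ 'm \<Rightarrow> real ^ 'm ^ 'n \<Rightarrow> bool" where
  "is_pseudoinverse A X \<longleftrightarrow>
     A ** X ** A = A \<and> X ** A ** X = X \<and>
     transpose (A ** X) = A ** X \<and> transpose (X ** A) = X ** A"

definition pseudoinverse :: "real ^ 'n ^ 'm \<Rightarrow> real ^ 'm ^ 'n" where
  "pseudoinverse A = (THE X. is_pseudoinverse A X)"

definition biharmonic_dist_sq :: "('a::finite \<Rightarrow> 'a \<Rightarrow> bool) \<Rightarrow> 'a \<Rightarrow> 'a \<Rightarrow> real" where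
  "biharmonic_dist_sq E u v =
     (let P = pseudoinverse (laplacian E ** laplacian E)
      in P $ u $ u + P $ v $ v - 2 * P $ u $ v)"

text \<open>The sum ranges over ordered pairs, hence the factor 1/2.\<close>

definition biharmonic_index :: "('a::finite \<Rightarrow> 'a \<Rightarrow> bool) \<Rightarrow> real" where
  "biharmonic_index E = (1 / 2) * (\<Sum>u\<in>UNIV. \<Sum>v\<in>UNIV. biharmonic_dist_sq E u v)"

definition cartesian_product ::
  "('a::finite \<Rightarrow> 'a \<Rightarrow> bool) \<Rightarrow> ('b::finite \<Rightarrow> 'b \<Rightarrow> bool) \<Rightarrow> 'a \<times> 'b \<Rightarrow> 'a \<times> 'b \<Rightarrow> bool" where
  "cartesian_product E1 E2 = (\<lambda>(u, v) (u', v'). (u = u' \<and> E2 v v') \<or> (v = v' \<and> E1 u u'))"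

end

theory Submission
  imports Defs
begin

text \<open>
  Expanding a symmetric matrix in an orthonormal eigenbasis turns the pseudoinverse of
  \<open>L\<^sup>2\<close> into the matrix with eigenvalues \<open>1 / \<lambda>\<^sup>2\<close>, where Isabelle's convention
  \<open>1 / 0 = 0\<close> deals with the kernel.  Its trace gives the biharmonic index, because the
  remaining sum of all entries vanishes: eigenvectors with non-zero eigenvalue are orthogonal to
  the constant vector.  Tensor products of eigenvectors of the factors form an eigenbasis for the
  Cartesian product, with eigenvalues \<open>\<lambda> + \<mu>\<close>; separating the smallest eigenvalue \<open>0\<close> of each
  factor yields the formula.
\<close>

text \<open>Otherwise the infix \<open>$\<close> for coefficients of power series clashes with vector components.\<close>

unbundle no Formal_Power_Series.fps_syntax

subsection \<open>Spectral theorem\<close>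

text \<open>The quadratic form \<open>x \<bullet> f x\<close> attains its maximum \<open>c\<close>
  on the compact unit sphere of \<open>S\<close>. At a maximiser \<open>v\<close> the residual
  \<open>h = f v - c v\<close> lies in \<open>S\<close>, and moving from \<open>v\<close> in the
  direction \<open>h\<close> forces \<open>h = 0\<close>.\<close>

lemma self_adjoint_eigenvector:
  fixes f :: "'a::euclidean_space \<Rightarrow> 'a"
  assumes lin: "linear f" and adj: "\<And>x y. f x \<bullet> y = x \<bullet> f y"
    and S: "subspace S" "f ` S \<subseteq> S" "S \<noteq> {0}"
  obtains v c where "v \<in> S" "norm v = 1" "f v = c *\<^sub>R v"
proof -
  let ?K = "S \<inter> sphere 0 1"
  have comp: "compact ?K"
    by (intro closed_Int_compact closed_subspace S compact_sphere)
  obtain z where z: "z \<in> S" "z \<noteq> 0"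
    using S subspace_0 by blast
  then have "z /\<^sub>R norm z \<in> ?K"
    using S by (auto simp: subspace_scale)
  then have ne: "?K \<noteq> {}" by blast
  have cont: "continuous_on ?K (\<lambda>x. x \<bullet> f x)"
    by (intro continuous_intros linear_continuous_on linear_conv_bounded_linear[THEN iffD1] lin)
  obtain v where v: "v \<in> ?K" and vmax: "\<And>y. y \<in> ?K \<Longrightarrow> y \<bullet> f y \<le> v \<bullet> f v"
    using continuous_attains_sup[OF comp ne cont] by blast
  define c where "c = v \<bullet> f v"
  have vv: "v \<bullet> v = 1" using v by (simp add: dot_square_norm)
  have le: "x \<bullet> f x \<le> c * (x \<bullet> x)" if "x \<in> S" for x
  proof (cases "x = 0")
    case False
    have "x /\<^sub>R norm x \<in> ?K" using that S False by (auto simp: subspace_scale)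
    from vmax[OF this] have "(x \<bullet> f x) / (norm x)\<^sup>2 \<le> c"
      by (simp add: linear_cmul[OF lin] c_def power2_eq_square divide_inverse mult.commute mult.left_commute)
    then show ?thesis using False by (simp add: field_simps dot_square_norm)
  qed (simp add: linear_0[OF lin])
  define h where "h = f v - c *\<^sub>R v"
  have hS: "h \<in> S"
    unfolding h_def using S v by (auto intro!: subspace_diff subspace_scale)
  have fv: "f v = h + c *\<^sub>R v" by (simp add: h_def)
  have vh: "v \<bullet> h = 0" by (simp add: h_def inner_diff_right c_def vv)
  define K where "K = c * (h \<bullet> h) - h \<bullet> f h"
  \<comment> \<open>This is \<open>le\<close> at \<open>v + t h\<close>: the constant terms cancel,
    and the first-order coefficient is twice \<open>h \<bullet> f v = h \<bullet> h\<close>.\<close>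
  have quad: "2 * t * (h \<bullet> h) \<le> t\<^sup>2 * K" for t
  proof -
    have "v + t *\<^sub>R h \<in> S" using S v hS by (auto intro!: subspace_add subspace_scale)
    from le[OF this] show ?thesis
      using adj[of v h] vv vh
      by (simp add: linear_add[OF lin] linear_cmul[OF lin] fv K_def inner_add_left inner_add_right
          power2_eq_square algebra_simps inner_commute)
  qed
  have "h \<bullet> h \<le> 0"
  proof (cases "K \<le> 0")
    case True then show ?thesis using quad[of 1] by simp
  next
    case False
    \<comment> \<open>For \<open>K > 0\<close> this \<open>t\<close> minimises
      \<open>t\<^sup>2 * K - 2 * t * (h \<bullet> h)\<close>.\<close>
    with quad[of "(h \<bullet> h) / K"] have "(h \<bullet> h) * (h \<bullet> h) \<le> 0"
      by (simp add: power2_eq_square field_simps)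
    then show ?thesis by (metis mult_le_0_iff)
  qed
  then have "h = 0" by (metis inner_ge_zero inner_eq_zero_iff order_antisym)
  then have "f v = c *\<^sub>R v" using fv by simp
  then show thesis using that v by auto
qed

text \<open>Induction on the dimension: after a unit eigenvector \<open>v\<close> is split off, its
  orthogonal complement \<open>T\<close> in \<open>S\<close> is again invariant, since
  \<open>v \<bullet> f x = f v \<bullet> x = c (v \<bullet> x) = 0\<close> there.\<close>

lemma self_adjoint_eigenbasis:
  fixes f :: "'a::euclidean_space \<Rightarrow> 'a"
  assumes lin: "linear f" and adj: "\<And>x y. f x \<bullet> y = x \<bullet> f y"
    and "subspace S" "f ` S \<subseteq> S"
  shows "\<exists>B\<subseteq>S. pairwise orthogonal B \<and> (\<forall>v\<in>B. norm v = 1 \<and> (\<exists>c. f v = c *\<^sub>R v)) \<and> span B = S"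
  using assms(3,4)
proof (induction "dim S" arbitrary: S rule: less_induct)
  case less
  show ?case
  proof (cases "S = {0}")
    case True then show ?thesis by (intro exI[of _ "{}"]) auto
  next
    case False
    obtain v c where v: "v \<in> S" "norm v = 1" "f v = c *\<^sub>R v"
      using self_adjoint_eigenvector[OF lin adj less.prems False] by blast
    define T where "T = {x \<in> S. v \<bullet> x = 0}"
    have T: "subspace T"
      using less.prems(1) unfolding T_def subspace_def by (auto simp: inner_add_right)
    have fT: "f ` T \<subseteq> T"
      using less.prems(2) v(3) by (auto simp: T_def adj[symmetric])
    have vv: "v \<bullet> v = 1" using v by (simp add: dot_square_norm)
    have "v \<notin> T" using vv by (simp add: T_def)
    moreover have "T \<subseteq> S" by (auto simp: T_def)
    ultimately have "T \<subset> S" using v(1) by blast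
    then have "dim T < dim S"
      using T less.prems(1) by (metis dim_psubset span_eq_iff)
    from less.hyps[OF this T fT] obtain B where B: "B \<subseteq> T" "pairwise orthogonal B"
      "\<forall>v\<in>B. norm v = 1 \<and> (\<exists>c. f v = c *\<^sub>R v)" "span B = T" by blast
    have "S \<subseteq> span (insert v B)"
    proof
      fix x assume "x \<in> S"
      then have "x - (v \<bullet> x) *\<^sub>R v \<in> T"
        using v vv less.prems(1) by (auto simp: T_def inner_diff_right subspace_diff subspace_scale)
      then show "x \<in> span (insert v B)" using B(4) span_breakdown_eq by blast
    qed
    moreover have "span (insert v B) \<subseteq> S"
      using B(1) v(1) less.prems(1) by (intro span_minimal) (auto simp: T_def)
    moreover have "pairwise orthogonal (insert v B)"
      using B(1,2) by (auto simp: pairwise_insert T_def orthogonal_def inner_commute)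
    ultimately show ?thesis
      using B v by (intro exI[of _ "insert v B"]) (auto simp: T_def)
  qed
qed

text \<open>The vectors are indexed by the coordinate type itself, so that orthonormality alone
  makes them a basis. The eigenvalues carry no order.\<close>

definition orthonormal_eigenbasis ::
  "real ^ 'n ^ 'n \<Rightarrow> ('n \<Rightarrow> real) \<Rightarrow> ('n \<Rightarrow> real ^ 'n) \<Rightarrow> bool" where
  "orthonormal_eigenbasis A l q \<longleftrightarrow>
     (\<forall>i j. q i \<bullet> q j = (if i = j then 1 else 0)) \<and> (\<forall>i. A *v q i = l i *s q i)"

lemma symmetric_matrix_inner:
  fixes A :: "real ^ 'n ^ 'n"
  assumes "transpose A = A"
  shows "(A *v x) \<bullet> y = x \<bullet> (A *v y)"
  using dot_lmul_matrix[of x A y] vector_transpose_matrix[of x A] assms by simp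

theorem symmetric_matrix_eigenbasis:
  fixes A :: "real ^ 'n ^ 'n"
  assumes "transpose A = A"
  obtains l q where "orthonormal_eigenbasis A l q"
proof -
  from self_adjoint_eigenbasis[OF matrix_vector_mul_linear symmetric_matrix_inner[OF assms] subspace_UNIV]
  obtain B where B: "pairwise orthogonal B"
    "\<forall>v\<in>B. norm v = 1 \<and> (\<exists>c. A *v v = c *\<^sub>R v)" "span B = UNIV" by auto
  have "0 \<notin> B" using B(2) by force
  then have ind: "independent B" using B(1) pairwise_orthogonal_independent by blast
  then have "finite B" by (rule independent_imp_finite)
  \<comment> \<open>The cardinality is what permits re-indexing \<open>B\<close> by
    \<open>'n\<close>.\<close>
  moreover have "card B = CARD('n)"
    using dim_span_eq_card_independent[OF ind] B(3) by simp
  ultimately obtain q where q: "bij_betw q (UNIV::'n set) B"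
    using finite_same_card_bij[of "UNIV::'n set" B] by auto
  then have qB: "q i \<in> B" for i by (auto simp: bij_betw_def)
  then have "\<forall>i. \<exists>c. A *v q i = c *\<^sub>R q i" using B(2) by blast
  then obtain l where l: "\<And>i. A *v q i = l i *\<^sub>R q i" by metis
  have "q i \<bullet> q j = (if i = j then 1 else 0)" for i j
  proof (cases "i = j")
    case True
    then show ?thesis using B(2) qB[of i] by (simp add: dot_square_norm)
  next
    case False
    then have "q i \<noteq> q j" using q by (auto simp: bij_betw_def inj_on_def)
    then show ?thesis
      using B(1) qB[of i] qB[of j] False by (auto simp: pairwise_def orthogonal_def)
  qed
  with l have "orthonormal_eigenbasis A l q"
    by (simp add: orthonormal_eigenbasis_def scalar_mult_eq_scaleR)
  then show thesis by (rule that)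
qed

section \<open>Functional calculus in an orthonormal basis\<close>

text \<open>This is \<open>Q diag(c) Q^T\<close>, where \<open>Q\<close> has the columns
  \<open>q k\<close>. For orthonormal \<open>q\<close>, matrix operations become pointwise
  operations on \<open>c\<close>.\<close>

definition spectral_matrix :: "('n::finite \<Rightarrow> real ^ 'n) \<Rightarrow> ('n \<Rightarrow> real) \<Rightarrow> real ^ 'n ^ 'n" where
  "spectral_matrix q c = (\<chi> i j. \<Sum>k\<in>UNIV. c k * q k $ i * q k $ j)"

lemma transpose_spectral_matrix: "transpose (spectral_matrix q c) = spectral_matrix q c"
  by (simp add: spectral_matrix_def transpose_def vec_eq_iff mult_ac)

lemma spectral_matrix_diff:
  "spectral_matrix q c - spectral_matrix q d = spectral_matrix q (\<lambda>i. c i - d i)"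
  by (simp add: spectral_matrix_def vec_eq_iff sum_subtractf algebra_simps)

lemma spectral_matrix_mult_vec: "spectral_matrix q c *v x = (\<Sum>k\<in>UNIV. (c k * (q k \<bullet> x)) *s q k)"
proof -
  have "(\<Sum>j\<in>UNIV. (\<Sum>k\<in>UNIV. c k * q k $ i * q k $ j) * x $ j)
      = (\<Sum>k\<in>UNIV. c k * (\<Sum>j\<in>UNIV. q k $ j * x $ j) * q k $ i)" for i
    by (simp add: sum_distrib_left sum_distrib_right mult_ac) (rule sum.swap)
  then show ?thesis
    by (simp add: spectral_matrix_def matrix_vector_mult_def inner_vec_def vec_eq_iff)
qed

context
  fixes q :: "'n::finite \<Rightarrow> real ^ 'n"
  assumes orthonormal: "\<And>i j. q i \<bullet> q j = (if i = j then 1 else 0)"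
begin

abbreviation (input) eigenvector_matrix :: "real ^ 'n ^ 'n" where
  "eigenvector_matrix \<equiv> (\<chi> i j. q j $ i)"

lemma orthonormal_columns:
  "transpose eigenvector_matrix ** eigenvector_matrix = mat 1"
  using orthonormal
  by (simp add: matrix_matrix_mult_def transpose_def mat_def vec_eq_iff inner_vec_def)

lemma spectral_matrix_conv_diag:
  "spectral_matrix q c = eigenvector_matrix ** (\<chi> i j. if i = j then c i else 0)
     ** transpose eigenvector_matrix"
  by (simp add: spectral_matrix_def matrix_matrix_mult_def transpose_def vec_eq_iff if_distrib
      mult_ac cong: if_cong)

text \<open>Completeness of the basis: \<open>Q\<close> is square, so \<open>Q^T Q = 1\<close>
  implies \<open>Q Q^T = 1\<close>. The case \<open>x = 1\<close> later expands arbitrary vectors in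
  the basis.\<close>

lemma spectral_matrix_const: "spectral_matrix q (\<lambda>_. x) = mat x"
proof -
  have "eigenvector_matrix ** transpose eigenvector_matrix = mat 1"
    using orthonormal_columns matrix_left_right_inverse by blast
  then have "(\<Sum>k\<in>UNIV. q k $ i * q k $ j) = (if i = j then 1 else 0)" for i j
    by (simp add: matrix_matrix_mult_def transpose_def mat_def vec_eq_iff)
  then show ?thesis
    by (simp add: spectral_matrix_def mat_def vec_eq_iff mult.assoc flip: sum_distrib_left)
qed

lemma spectral_matrix_mult_basis: "spectral_matrix q c *v q i = c i *s q i"
proof -
  have "(c k * (q k \<bullet> q i)) *s q k = (if k = i then c i *s q i else 0)" for k
    by (simp add: orthonormal)
  then show ?thesis by (simp add: spectral_matrix_mult_vec)
qed

lemma matrix_eq_on_basis: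
  assumes "\<And>i. A *v q i = B *v q i"
  shows "A = (B :: real ^ 'n ^ 'n)"
proof -
  have expand: "M *v x = (\<Sum>k\<in>UNIV. (q k \<bullet> x) *\<^sub>R (M *v q k))" for M :: "real ^ 'n ^ 'n" and x
  proof -
    have "x = (\<Sum>k\<in>UNIV. (q k \<bullet> x) *\<^sub>R q k)"
      using spectral_matrix_mult_vec[of q "\<lambda>_. 1" x]
      by (simp add: spectral_matrix_const scalar_mult_eq_scaleR)
    then have "M *v x = M *v (\<Sum>k\<in>UNIV. (q k \<bullet> x) *\<^sub>R q k)" by simp
    also have "\<dots> = (\<Sum>k\<in>UNIV. (q k \<bullet> x) *\<^sub>R (M *v q k))"
      by (simp add: linear_sum[OF matrix_vector_mul_linear] linear_cmul[OF matrix_vector_mul_linear])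
    finally show ?thesis .
  qed
  have "A *v x = B *v x" for x
    using expand[of A x] expand[of B x] assms by simp
  then show ?thesis by (simp add: matrix_eq)
qed

text \<open>Both sides scale each \<open>q i\<close> by \<open>c i * d i\<close>.\<close>

lemma spectral_matrix_mult:
  "spectral_matrix q c ** spectral_matrix q d = spectral_matrix q (\<lambda>i. c i * d i)"
  by (rule matrix_eq_on_basis)
    (simp add: spectral_matrix_mult_basis vector_scalar_commute mult.commute
      flip: matrix_vector_mul_assoc)

lemma det_spectral_matrix: "det (spectral_matrix q c) = prod c UNIV"
proof -
  have "det (transpose eigenvector_matrix) * det eigenvector_matrix = 1"
    using det_mul[of "transpose eigenvector_matrix" eigenvector_matrix]
    by (simp add: orthonormal_columns del: det_transpose)
  moreover have "det ((\<chi> i j. if i = j then c i else 0) :: real ^ 'n ^ 'n) = prod c UNIV"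
    by (subst det_diagonal) auto
  ultimately show ?thesis
    by (simp add: spectral_matrix_conv_diag det_mul mult_ac)
qed

lemma trace_spectral_matrix: "(\<Sum>i\<in>UNIV. spectral_matrix q c $ i $ i) = sum c UNIV"
proof -
  have "(\<Sum>i\<in>UNIV. spectral_matrix q c $ i $ i) = (\<Sum>k\<in>UNIV. c k * (q k \<bullet> q k))"
    by (simp add: spectral_matrix_def inner_vec_def sum_distrib_left mult.assoc) (rule sum.swap)
  then show ?thesis by (simp add: orthonormal)
qed

end

lemma orthonormal_eigenbasisD:
  assumes "orthonormal_eigenbasis A l q"
  shows "q i \<bullet> q j = (if i = j then 1 else 0)" "A *v q i = l i *s q i" "A = spectral_matrix q l"
proof -
  show o: "q i \<bullet> q j = (if i = j then 1 else 0)" for i j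
    using assms by (simp add: orthonormal_eigenbasis_def)
  show a: "A *v q i = l i *s q i" for i
    using assms by (simp add: orthonormal_eigenbasis_def)
  show "A = spectral_matrix q l"
    by (rule matrix_eq_on_basis[OF o]) (simp add: a spectral_matrix_mult_basis[OF o])
qed

section \<open>Characteristic polynomial\<close>

text \<open>Evaluation at \<open>x\<close> is a ring homomorphism, hence commutes with the Leibniz
  expansion of the determinant.\<close>

lemma poly_characteristic_poly: "poly (characteristic_poly A) x = det (mat x - A)"
proof -
  have "poly ((mat [:0, 1:] - (\<chi> i j. [:A $ i $ j:])) $ i $ j) x = (mat x - A) $ i $ j" for i j
    by (simp add: mat_def)
  then show ?thesis
    unfolding characteristic_poly_def det_def
    by (simp only: poly_sum poly_mult poly_prod poly_of_int)
qed

text \<open>Since \<open>mat x - A\<close> is the spectral matrix of \<open>x - l i\<close>, the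
  polynomial takes the same values as the product of the \<open>x - l i\<close>, hence equals it.
  This links root multiplicities to the eigenbasis.\<close>

lemma proots_characteristic_poly:
  assumes "orthonormal_eigenbasis A l q"
  shows "proots (characteristic_poly A) = image_mset l (mset_set UNIV)"
proof -
  note D = orthonormal_eigenbasisD[OF assms]
  have "poly (characteristic_poly A) x = poly (\<Prod>i\<in>UNIV. [:- l i, 1:]) x" for x
    using D(3) det_spectral_matrix[OF D(1), of "\<lambda>i. x - l i"]
    by (simp add: poly_characteristic_poly poly_prod
        spectral_matrix_const[OF D(1), symmetric] spectral_matrix_diff)
  then have "characteristic_poly A = (\<Prod>i\<in>UNIV. [:- l i, 1:])"
    by (simp add: poly_eq_poly_eq_iff[symmetric] fun_eq_iff)
  moreover have "proots (\<Prod>i\<in>X. [:- l i, 1:]) = image_mset l (mset_set X)" if "finite X" for X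
    using that
  proof (induction X)
    case (insert a X)
    then show ?case by (simp add: proots_mult del: mult_pCons_left)
  qed simp
  ultimately show ?thesis by simp
qed

subsection \<open>Pseudoinverse\<close>

text \<open>\<open>A ** X\<close> and \<open>A ** Y\<close> are both the orthogonal projection onto
  the range of \<open>A\<close>; \<open>X ** A\<close> and \<open>Y ** A\<close> agree likewise.
  Then \<open>X = X A X = Y A X = Y A Y = Y\<close>.\<close>

lemma is_pseudoinverse_unique:
  assumes X: "is_pseudoinverse A X" and Y: "is_pseudoinverse A Y"
  shows "X = Y"
proof -
  note x = X[unfolded is_pseudoinverse_def] and y = Y[unfolded is_pseudoinverse_def]
  have "A ** X = (A ** Y) ** (A ** X)" using y by (simp add: matrix_mul_assoc)
  also have "\<dots> = transpose ((A ** X) ** (A ** Y))"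
    using x y by (simp add: matrix_transpose_mul)
  also have "\<dots> = A ** Y" using x y by (simp add: matrix_mul_assoc)
  finally have 1: "A ** X = A ** Y" .
  have "X ** A = (X ** A) ** (Y ** A)" using y by (simp add: matrix_mul_assoc[symmetric])
  also have "\<dots> = transpose ((Y ** A) ** (X ** A))"
    using x y by (simp add: matrix_transpose_mul)
  also have "\<dots> = Y ** A" using x y by (simp add: matrix_mul_assoc[symmetric])
  finally have 2: "X ** A = Y ** A" .
  have "X = X ** A ** X" using x by simp
  also have "\<dots> = Y ** A ** Y" using 1 2 by (simp add: matrix_mul_assoc[symmetric])
  finally show ?thesis using y by simp
qed

lemma pseudoinverse_eqI: "is_pseudoinverse A X \<Longrightarrow> pseudoinverse A = X"
  unfolding pseudoinverse_def by (blast intro: is_pseudoinverse_unique)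

lemma pseudoinverse_spectral_matrix:
  assumes "\<And>i j. q i \<bullet> q j = (if i = j then 1 else 0)"
  shows "pseudoinverse (spectral_matrix q c) = spectral_matrix q (\<lambda>i. 1 / c i)"
proof -
  \<comment> \<open>For \<open>c i = 0\<close> both identities read \<open>0 = 0\<close>, because
    \<open>1 / 0 = 0\<close>.\<close>
  have "c i * (1 / c i) * c i = c i" "1 / c i * c i * (1 / c i) = 1 / c i" for i by simp_all
  then have "is_pseudoinverse (spectral_matrix q c) (spectral_matrix q (\<lambda>i. 1 / c i))"
    by (simp only: is_pseudoinverse_def spectral_matrix_mult[OF assms] transpose_spectral_matrix simp_thms)
  then show ?thesis by (rule pseudoinverse_eqI)
qed

subsection \<open>Laplacian spectrum and biharmonic index\<close>

lemma transpose_laplacian: "simple_graph E \<Longrightarrow> transpose (laplacian E) = laplacian E"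
  by (auto simp: simple_graph_def laplacian_def degree_matrix_def adjacency_matrix_def
      transpose_def vec_eq_iff dest: sympD)

text \<open>The degree contributes one copy of \<open>x $ u\<close> per neighbour. Positivity, the
  kernel and the spectrum of products are all read off this difference form.\<close>

lemma laplacian_mult_vec: "(laplacian E *v x) $ u = (\<Sum>w | E u w. x $ u - x $ w)"
proof -
  have "(laplacian E *v x) $ u =
      (\<Sum>w\<in>UNIV. (if w = u then real (card {w. E u w}) * x $ w else 0) - (if E u w then x $ w else 0))"
    by (auto simp: laplacian_def degree_matrix_def adjacency_matrix_def matrix_vector_mult_def
        algebra_simps intro!: sum.cong)
  also have "\<dots> = (\<Sum>w | E u w. x $ u - x $ w)"
    by (simp add: sum_subtractf sum.inter_filter[symmetric])
  finally show ?thesis .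
qed

text \<open>Averaging the quadratic form with its copy under exchange of \<open>u\<close> and
  \<open>w\<close> turns it into half a sum of squares over ordered adjacent pairs.\<close>

lemma laplacian_nonneg:
  assumes "simple_graph E"
  shows "0 \<le> x \<bullet> (laplacian E *v x)"
proof -
  define e where "e u w = (of_bool (E u w) :: real)" for u w
  define S where "S = (\<Sum>u\<in>UNIV. \<Sum>w\<in>UNIV. e u w * (x $ u * (x $ u - x $ w)))"
  have sym: "e u w = e w u" for u w
    using assms by (auto simp: e_def simple_graph_def dest: sympD)
  have "(\<Sum>w | E u w. x $ u * (x $ u - x $ w)) = (\<Sum>w\<in>UNIV. e u w * (x $ u * (x $ u - x $ w)))" for u
    unfolding e_def by (rule sum.mono_neutral_cong_left) auto
  then have "x \<bullet> (laplacian E *v x) = S"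
    by (simp add: S_def inner_vec_def laplacian_mult_vec sum_distrib_left)
  moreover have "S = (\<Sum>u\<in>UNIV. \<Sum>w\<in>UNIV. e u w * (x $ w * (x $ w - x $ u)))"
    unfolding S_def by (subst sum.swap) (simp add: sym)
  then have "S + S = (\<Sum>u\<in>UNIV. \<Sum>w\<in>UNIV.
      e u w * (x $ u * (x $ u - x $ w)) + e u w * (x $ w * (x $ w - x $ u)))"
    by (simp add: S_def sum.distrib)
  also have "\<dots> = (\<Sum>u\<in>UNIV. \<Sum>w\<in>UNIV. e u w * (x $ u - x $ w)\<^sup>2)"
    by (intro sum.cong refl) (simp add: power2_eq_square algebra_simps)
  also have "\<dots> \<ge> 0" by (simp add: sum_nonneg e_def)
  ultimately show ?thesis by simp
qed

lemma laplacian_kernel: "laplacian E *v 1 = 0"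
  by (simp add: vec_eq_iff laplacian_mult_vec)

context
  fixes E :: "'a::finite \<Rightarrow> 'a \<Rightarrow> bool" and l q
  assumes simple: "simple_graph E" and basis: "orthonormal_eigenbasis (laplacian E) l q"
begin

lemma laplacian_basis_nonneg: "0 \<le> l i"
  using laplacian_nonneg[OF simple, of "q i"] orthonormal_eigenbasisD(1,2)[OF basis]
  by (simp add: scalar_mult_eq_scaleR)

text \<open>Self-adjointness moves the Laplacian onto the constant vector, which it kills.\<close>

lemma laplacian_basis_kernel: "l i * (q i \<bullet> 1) = 0"
proof -
  have "(laplacian E *v q i) \<bullet> 1 = q i \<bullet> (laplacian E *v 1)"
    by (rule symmetric_matrix_inner[OF transpose_laplacian[OF simple]])
  then show ?thesis
    by (simp add: laplacian_kernel orthonormal_eigenbasisD(2)[OF basis] scalar_mult_eq_scaleR)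
qed

text \<open>Otherwise the constant vector would be orthogonal to the whole basis and so
  vanish.\<close>

lemma laplacian_basis_zero: "0 \<in> range l"
proof (rule ccontr)
  assume "0 \<notin> range l"
  then have "q i \<bullet> 1 = 0" for i using laplacian_basis_kernel[of i] by (auto simp: image_iff)
  then have "(1 :: real ^ 'a) = 0"
    using spectral_matrix_mult_vec[of q "\<lambda>_. 1" 1]
      spectral_matrix_const[OF orthonormal_eigenbasisD(1)[OF basis], of 1] by simp
  then show False by (simp add: vec_eq_iff)
qed

lemma biharmonic_index_eigenbasis:
  "biharmonic_index E = real CARD('a) * (\<Sum>i\<in>UNIV. 1 / (l i)\<^sup>2)"
proof -
  note D = orthonormal_eigenbasisD[OF basis]
  define P where "P = pseudoinverse (laplacian E ** laplacian E)"
  have P: "P = spectral_matrix q (\<lambda>i. 1 / (l i)\<^sup>2)"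
    unfolding P_def
    by (subst (1 2) D(3))
      (simp add: spectral_matrix_mult[OF D(1)] pseudoinverse_spectral_matrix[OF D(1)] power2_eq_square)
  have "P *v 1 = 0"
    unfolding P spectral_matrix_mult_vec
  proof (intro sum.neutral ballI)
    fix k
    \<comment> \<open>If \<open>l k = 0\<close>, the first factor is \<open>1 / 0 = 0\<close>;
      otherwise the second one vanishes.\<close>
    have "1 / (l k)\<^sup>2 * (q k \<bullet> 1) = 0" using laplacian_basis_kernel[of k] by auto
    then show "(1 / (l k)\<^sup>2 * (q k \<bullet> 1)) *s q k = 0" by simp
  qed
  then have rows: "(\<Sum>v\<in>UNIV. P $ u $ v) = 0" for u
    by (simp add: vec_eq_iff matrix_vector_mult_def)
  have tr: "(\<Sum>u\<in>UNIV. P $ u $ u) = (\<Sum>i\<in>UNIV. 1 / (l i)\<^sup>2)"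
    unfolding P by (rule trace_spectral_matrix[OF D(1)])
  have "biharmonic_index E = (1 / 2) * (\<Sum>u\<in>UNIV. \<Sum>v\<in>UNIV. P $ u $ u + P $ v $ v - 2 * P $ u $ v)"
    by (simp add: biharmonic_index_def biharmonic_dist_sq_def P_def Let_def)
  \<comment> \<open>The mixed terms vanish by \<open>rows\<close>; the two diagonal terms each give
    \<open>CARD('a)\<close> times the trace, which absorbs the factor 1/2.\<close>
  also have "\<dots> = real CARD('a) * (\<Sum>u\<in>UNIV. P $ u $ u)"
    by (simp add: sum.distrib sum_subtractf rows flip: sum_distrib_left)
  finally show ?thesis by (simp add: tr)
qed

text \<open>All eigenvalues are nonnegative and 0 is among them, so the sorted list starts with 0.
  This carries sums over an eigenbasis over to the ordered eigenvalues.\<close>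

lemma sum_laplacian_eigenvalue:
  fixes f :: "real \<Rightarrow> real"
  shows "(\<Sum>i\<in>UNIV. f (l i)) = f 0 + (\<Sum>i = 2..CARD('a). f (laplacian_eigenvalue E i))"
proof -
  define xs where "xs = sorted_list_of_multiset (proots (characteristic_poly (laplacian E)))"
  have m: "mset xs = image_mset l (mset_set UNIV)"
    by (simp add: xs_def proots_characteristic_poly[OF basis])
  have len: "length xs = CARD('a)" by (metis m size_mset size_image_mset size_mset_set)
  have set: "set xs = range l" by (metis m set_mset_mset set_image_mset finite_set_mset_mset_set finite)
  have "sorted xs" by (simp add: xs_def)
  obtain y ys where xs: "xs = y # ys"
    using laplacian_basis_zero set by (cases xs) auto
  have "y \<in> range l" by (simp add: xs flip: set)
  then have "0 \<le> y" using laplacian_basis_nonneg by blast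
  moreover have "y \<le> 0"
    using laplacian_basis_zero \<open>sorted xs\<close> unfolding set[symmetric] xs by auto
  ultimately have ys: "xs = 0 # ys" using xs by simp
  have "(\<Sum>i\<in>UNIV. f (l i)) = sum_mset (image_mset f (mset xs))"
    by (simp add: m sum_unfold_sum_mset multiset.map_comp comp_def)
  also have "\<dots> = f 0 + sum_list (map f ys)" by (simp add: ys sum_mset_sum_list flip: mset_map)
  also have "sum_list (map f ys) = (\<Sum>k = 0..<length ys. f (xs ! Suc k))"
    by (simp add: ys sum_list_sum_nth)
  \<comment> \<open>Eigenvalues are numbered from 1 and list entries from 0, so position
    \<open>k\<close> of the tail \<open>ys\<close> is eigenvalue number
    \<open>k + 2\<close>.\<close>
  also have "\<dots> = (\<Sum>i = 2..CARD('a). f (xs ! (i - 1)))"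
    using len unfolding ys
    by (intro sum.reindex_bij_witness[of _ "\<lambda>i. i - 2" "\<lambda>i. i + 2"]) auto
  finally show ?thesis by (simp add: laplacian_eigenvalue_def xs_def)
qed

end

section \<open>Spectrum of the Cartesian product\<close>

lemma simple_graph_cartesian_product:
  "simple_graph G1 \<Longrightarrow> simple_graph G2 \<Longrightarrow> simple_graph (cartesian_product G1 G2)"
  by (auto simp: simple_graph_def cartesian_product_def symp_def irreflp_def)

text \<open>Inner products of tensor products factorise, which gives orthonormality. A step to a
  neighbour changes only one coordinate, so each half of the neighbourhood lets the Laplacian of one
  factor act, and the eigenvalues add.\<close>

lemma cartesian_product_eigenbasis:
  assumes "simple_graph G1" "simple_graph G2"
    and b1: "orthonormal_eigenbasis (laplacian G1) l q"
    and b2: "orthonormal_eigenbasis (laplacian G2) m r"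
  shows "orthonormal_eigenbasis (laplacian (cartesian_product G1 G2))
    (\<lambda>(i, j). l i + m j) (\<lambda>(i, j). \<chi> p. q i $ fst p * r j $ snd p)"
proof -
  define t where "t = (\<lambda>(i, j). \<chi> p. q i $ fst p * r j $ snd p)"
  note D = orthonormal_eigenbasisD[OF b1] and D' = orthonormal_eigenbasisD[OF b2]
  have "t (i, j) \<bullet> t (i', j') = (q i \<bullet> q i') * (r j \<bullet> r j')" for i j i' j'
    by (simp add: t_def inner_vec_def sum_product sum.cartesian_product UNIV_Times_UNIV[symmetric]
        case_prod_beta mult_ac del: UNIV_Times_UNIV)
  moreover have "(laplacian (cartesian_product G1 G2) *v t (i, j)) $ (u, v)
      = (l i + m j) * t (i, j) $ (u, v)" for i j u v
  proof -
    have nb: "{w. cartesian_product G1 G2 (u, v) w} = (\<lambda>v'. (u, v')) ` {v'. G2 v v'} \<union> (\<lambda>u'. (u', v)) ` {u'. G1 u u'}"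
      by (auto simp: cartesian_product_def)
    \<comment> \<open>A common element could only be \<open>(u, v)\<close> itself, which would
      require a loop.\<close>
    have disj: "(\<lambda>v'. (u, v')) ` {v'. G2 v v'} \<inter> (\<lambda>u'. (u', v)) ` {u'. G1 u u'} = {}"
      using assms(1,2) by (auto simp: simple_graph_def irreflp_def)
    have "(laplacian (cartesian_product G1 G2) *v t (i, j)) $ (u, v)
      = q i $ u * (\<Sum>w | G2 v w. r j $ v - r j $ w) + (\<Sum>w | G1 u w. q i $ u - q i $ w) * r j $ v"
      unfolding laplacian_mult_vec nb
      by (subst sum.union_disjoint[OF _ _ disj])
        (simp_all add: sum.reindex inj_on_def t_def sum_distrib_left sum_distrib_right algebra_simps)
    also have "\<dots> = (l i + m j) * t (i, j) $ (u, v)"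
      using D(2)[of i] D'(2)[of j]
      by (simp add: t_def algebra_simps flip: laplacian_mult_vec)
    finally show ?thesis .
  qed
  ultimately have "orthonormal_eigenbasis (laplacian (cartesian_product G1 G2)) (\<lambda>(i, j). l i + m j) t"
    using D(1) D'(1) by (auto simp: orthonormal_eigenbasis_def vec_eq_iff)
  then show ?thesis by (simp add: t_def)
qed

theorem theorem6p3:
  fixes G1 :: "'a::finite \<Rightarrow> 'a \<Rightarrow> bool" and G2 :: "'b::finite \<Rightarrow> 'b \<Rightarrow> bool"
  assumes "connected_graph G1" and "connected_graph G2"
  shows "biharmonic_index (cartesian_product G1 G2) =
    real CARD('a) * real CARD('b) *
      ((\<Sum>i = 2..CARD('a). 1 / (laplacian_eigenvalue G1 i)\<^sup>2)
     + (\<Sum>j = 2..CARD('b). 1 / (laplacian_eigenvalue G2 j)\<^sup>2)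
     + (\<Sum>i = 2..CARD('a). \<Sum>j = 2..CARD('b).
          1 / (laplacian_eigenvalue G1 i + laplacian_eigenvalue G2 j)\<^sup>2))"
proof -
  have s: "simple_graph G1" "simple_graph G2" using assms by (auto simp: connected_graph_def)
  obtain l q where b1: "orthonormal_eigenbasis (laplacian G1) l q"
    using symmetric_matrix_eigenbasis[OF transpose_laplacian[OF s(1)]] by blast
  obtain m r where b2: "orthonormal_eigenbasis (laplacian G2) m r"
    using symmetric_matrix_eigenbasis[OF transpose_laplacian[OF s(2)]] by blast
  have "(\<Sum>p\<in>UNIV. 1 / ((\<lambda>(i, j). l i + m j) p)\<^sup>2) = (\<Sum>i\<in>UNIV. \<Sum>j\<in>UNIV. 1 / (l i + m j)\<^sup>2)"
    by (simp add: sum.cartesian_product case_prod_beta)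
  \<comment> \<open>For each fixed \<open>x = l i\<close>, the eigenvalue 0 of the second factor
    contributes \<open>1 / (l i)\<^sup>2\<close>.\<close>
  also have "\<dots> = (\<Sum>i\<in>UNIV. 1 / (l i)\<^sup>2 + (\<Sum>j = 2..CARD('b). 1 / (l i + laplacian_eigenvalue G2 j)\<^sup>2))"
    using sum_laplacian_eigenvalue[OF s(2) b2, of "\<lambda>y. 1 / (x + y)\<^sup>2" for x] by simp
  \<comment> \<open>The eigenvalue 0 of the first factor contributes
    \<open>1 / 0\<^sup>2 = 0\<close> plus the sum over \<open>G2\<close> alone. The pair of both
    zeros thus adds nothing.\<close>
  also have "\<dots> = (\<Sum>i = 2..CARD('a). 1 / (laplacian_eigenvalue G1 i)\<^sup>2)
     + (\<Sum>j = 2..CARD('b). 1 / (laplacian_eigenvalue G2 j)\<^sup>2)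
     + (\<Sum>i = 2..CARD('a). \<Sum>j = 2..CARD('b).
          1 / (laplacian_eigenvalue G1 i + laplacian_eigenvalue G2 j)\<^sup>2)"
    by (subst sum_laplacian_eigenvalue[OF s(1) b1,
          of "\<lambda>x. 1 / x\<^sup>2 + (\<Sum>j = 2..CARD('b). 1 / (x + laplacian_eigenvalue G2 j)\<^sup>2)"])
      (simp add: sum.distrib)
  finally show ?thesis
    using biharmonic_index_eigenbasis[OF simple_graph_cartesian_product[OF s]
        cartesian_product_eigenbasis[OF s b1 b2]]
    by simp
qed

end
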